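(* For the modified Leslie--Gower model with Beverton--Holt-type response on its double-zero parameter set (described in the context), let $\mathcal R_Z(u)=\sum_{k\ge2}g_ku^k$ be its distinguished restriction. On the algebraic locus $\beta=0$, equivalently $\Theta:=cr+2(r+1)x_0-1=0$, one has $$g_k=0,\qquad k\ge3,$$ and the distinguished restriction becomes exactly quadratic: $$\mathcal R_Z(u)=-r(r+1)x_0u^2.$$
   Context: The model is $$\dot x=x(1-x)-\frac{\alpha x}{x+\beta}-rxy,\qquad \dot y=\frac{\delta y}{1+\eta y}\Bigl(1-\frac{y}{x+c}\Bigr),$$ with a positive equilibrium $E=(x_0,x_0+c)$. The double-zero parameter set is $$\beta=\frac{1-cr-2(r+1)x_0}{r+1},\quad \delta=rx_0\bigl(1+\eta(x_0+c)\bigr),\quad \alpha=\frac{(cr+(r+1)x_0-1)^2}{r+1},$$ so that $\Theta=-(r+1)\beta$. On this set the linearization is $J(E)=rx_0\begin{pmatrix}1&-1\\1&-1\end{pmatrix}$, assumed to be a nonzero nilpotent matrix (that is, $rx_0\neq0$), and Jordan coordinates $(u,v)$ are given by $x=x_0+u+\frac{v}{rx_0}$, $y=x_0+c+u$, in which the linear part is $\begin{pmatrix}0&1\\0&0\end{pmatrix}$. The distinguished restriction $\mathcal R_Z(u)$ is the second component $\dot v$ of the system in these coordinates evaluated at $v=0$; with $\Delta:=cr+(r+1)x_0-1\neq0$ it equals $$\mathcal R_Z(u)=\frac{r(r+1)^2x_0\,u^2(x_0+u)}{\Delta-(r+1)u}.$$ *)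

theory Defs
  imports "HOL-Analysis.Analysis"
begin

text \<open>
  The modified Leslie--Gower vector field with Beverton--Holt-type response. It is meaningful
  where \<open>x + \<beta>\<close>, \<open>1 + \<eta> * y\<close> and \<open>x + c\<close> are nonzero.
\<close>

definition lg_field ::
  "real \<Rightarrow> real \<Rightarrow> real \<Rightarrow> real \<Rightarrow> real \<Rightarrow> real \<Rightarrow> real \<times> real \<Rightarrow> real \<times> real" where
  "lg_field \<alpha> \<beta> r \<delta> \<eta> c =
     (\<lambda>(x, y). (x * (1 - x) - \<alpha> * x / (x + \<beta>) - r * x * y,
               \<delta> * y / (1 + \<eta> * y) * (1 - y / (x + c))))"

definition jordan_map :: "real \<Rightarrow> real \<Rightarrow> real \<times> real \<Rightarrow> real \<times> real" where
  "jordan_map r x0 = (\<lambda>(u, v). (u + v / (r * x0), u))"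

text \<open>
  The substitution \<open>(x, y) = (x0, x0 + c) + P (u, v)\<close>, with \<open>P\<close> the linear map above (bijective
  when \<open>r * x0 \<noteq> 0\<close>), gives \<open>P (u', v') = (x', y')\<close> for the velocities, hence the inverse below.
\<close>

definition jordan_field ::
  "real \<Rightarrow> real \<Rightarrow> real \<Rightarrow> real \<Rightarrow> real \<Rightarrow> real \<Rightarrow> real \<Rightarrow> real \<times> real \<Rightarrow> real \<times> real" where
  "jordan_field \<alpha> \<beta> r \<delta> \<eta> c x0 w =
     inv (jordan_map r x0) (lg_field \<alpha> \<beta> r \<delta> \<eta> c ((x0, x0 + c) + jordan_map r x0 w))"

definition distinguished_restriction ::
  "real \<Rightarrow> real \<Rightarrow> real \<Rightarrow> real \<Rightarrow> real \<Rightarrow> real \<Rightarrow> real \<Rightarrow> real \<Rightarrow> real" where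
  "distinguished_restriction \<alpha> \<beta> r \<delta> \<eta> c x0 u = snd (jordan_field \<alpha> \<beta> r \<delta> \<eta> c x0 (u, 0))"

definition taylor_coeff :: "(real \<Rightarrow> real) \<Rightarrow> nat \<Rightarrow> real" where
  "taylor_coeff f k = (deriv ^^ k) f 0 / fact k"

end

theory Submission
  imports Defs "HOL-Complex_Analysis.Laurent_Convergence"
begin

text \<open>
  On the line \<open>v = 0\<close> one has \<open>x = x0 + u\<close> and \<open>y = x + c\<close>: this is exactly the predator nullcline,
  so \<open>y'\<close> vanishes there and the distinguished restriction is \<open>r * x0 * x'\<close>. Write \<open>s = r + 1\<close> and
  \<open>\<Delta> = c * r + s * x0 - 1\<close>. The double-zero conditions give \<open>s * (x + \<beta>) = s * u - \<Delta>\<close> and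
  \<open>s * \<alpha> = \<Delta>\<^sup>2\<close>, hence
  \<open>x' = x * (- (\<Delta> + s * u) - \<Delta>\<^sup>2 / (s * u - \<Delta>)) = s\<^sup>2 * u\<^sup>2 * x / (\<Delta> - s * u)\<close>,
  the rational function of \<open>distinguished_restriction_eq\<close>. As \<open>\<Delta> \<noteq> 0\<close>, it is \<open>u\<^sup>2\<close> times a function
  that is analytic at \<open>0\<close>, so it is the sum of its Taylor series, which starts at degree two.

  Since \<open>\<Delta> = - s * (x0 + \<beta>)\<close>, the case \<open>\<beta> = 0\<close> is the one where the denominator equals
  \<open>- s * (x0 + u)\<close>. It then cancels against the factor \<open>x = x0 + u\<close> of the numerator, leaving the
  pure square. A real function that agrees near \<open>0\<close> with a convergent power series has that series
  as its Taylor series (\<open>taylor_coeff_eq_fps_nth\<close>), so all other coefficients vanish.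
\<close>

lemma higher_deriv_has_fps_expansion:
  fixes f :: "'a :: {banach, real_normed_field} \<Rightarrow> 'a"
  assumes "f has_fps_expansion F"
  shows "(deriv ^^ n) f has_fps_expansion (fps_deriv ^^ n) F"
  by (induction n) (auto intro: has_fps_expansion_deriv assms)

lemma has_fps_expansion_at_0:
  assumes "f has_fps_expansion F"
  shows "f 0 = fps_nth F 0"
  using assms
  by (auto simp: has_fps_expansion_def eval_fps_at_0 dest: eventually_nhds_x_imp_x)

text \<open>
  Differentiating \<open>k\<close> times acts termwise on the series, and the value at \<open>0\<close> picks out \<open>fact k\<close>
  times its \<open>k\<close>-th coefficient. This makes Taylor coefficients computable without derivatives.
\<close>

lemma taylor_coeff_eq_fps_nth:
  assumes "f has_fps_expansion F"
  shows "taylor_coeff f k = fps_nth F k"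
  using has_fps_expansion_at_0[OF higher_deriv_has_fps_expansion[OF assms]]
  by (simp add: taylor_coeff_def fps_0th_higher_deriv)

lemma has_fps_expansion_sums:
  assumes "f has_fps_expansion F"
  obtains \<rho> where "\<rho> > 0" "\<And>u. norm u < \<rho> \<Longrightarrow> (\<lambda>k. fps_nth F k * u ^ k) sums f u"
proof -
  have "eventually (\<lambda>u. u \<in> eball 0 (fps_conv_radius F)) (nhds 0)"
    using assms
    by (intro eventually_nhds_in_open) (auto simp: has_fps_expansion_def zero_ereal_def)
  moreover have "eventually (\<lambda>u. eval_fps F u = f u) (nhds 0)"
    using assms by (auto simp: has_fps_expansion_def)
  ultimately have "eventually (\<lambda>u. (\<lambda>k. fps_nth F k * u ^ k) sums f u) (nhds 0)"
  proof eventually_elim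
    case (elim u)
    then show ?case using sums_eval_fps[of u F] by simp
  qed
  then show ?thesis
    using that by (auto simp: eventually_nhds_metric)
qed

lemma inv_jordan_map:
  assumes "r * x0 \<noteq> 0"
  shows "inv (jordan_map r x0) (a, b) = (b, r * x0 * (a - b))"
proof (rule inv_f_eq)
  show "inj (jordan_map r x0)"
    using assms by (auto simp: inj_def jordan_map_def)
  show "jordan_map r x0 (b, r * x0 * (a - b)) = (a, b)"
    using assms by (simp add: jordan_map_def)
qed

text \<open>
  Only the prey equation contributes, because the points with \<open>v = 0\<close> satisfy \<open>y = x + c\<close>. At the
  point \<open>x + c = 0\<close>, where the quotient \<open>y / (x + c)\<close> is not meaningful, \<open>y\<close> itself is \<open>0\<close>, and
  at \<open>1 + \<eta> * y = 0\<close> the convention for division by zero gives \<open>0\<close>, so the formula holds for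
  every \<open>u\<close>.
\<close>

lemma distinguished_restriction_prey:
  assumes "r * x0 \<noteq> 0"
  shows "distinguished_restriction \<alpha> \<beta> r \<delta> \<eta> c x0 u =
    r * x0 * ((x0 + u) * (1 - (x0 + u)) - \<alpha> * (x0 + u) / (x0 + u + \<beta>)
      - r * (x0 + u) * (x0 + u + c))"
proof -
  have y: "x0 + c + u = x0 + u + c" by simp
  have "\<delta> * (x0 + u + c) / (1 + \<eta> * (x0 + u + c)) * (1 - (x0 + u + c) / (x0 + u + c)) = 0"
    by (cases "x0 + u + c = 0") auto
  then show ?thesis
    unfolding distinguished_restriction_def jordan_field_def
    by (simp only: jordan_map_def[of r x0, THEN fun_cong, of "(u, 0)"] lg_field_def
        case_prod_conv plus_prod_def fst_conv snd_conv div_0 add_0_right y inv_jordan_map[OF assms] diff_zero)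
qed

text \<open>
  The numerator collapses because \<open>1 - x - r * (x + c) = - (\<Delta> + s * u)\<close> and
  \<open>\<alpha> / (x + \<beta>) = \<Delta>\<^sup>2 / (s * u - \<Delta>)\<close>, so that the terms in \<open>\<Delta>\<^sup>2\<close> cancel. The excluded value of
  \<open>u\<close> is the one where \<open>x + \<beta> = 0\<close>.
\<close>

lemma distinguished_restriction_eq:
  assumes "r * x0 \<noteq> 0" and s: "r + 1 \<noteq> 0"
    and \<beta>: "\<beta> = (1 - c * r - 2 * (r + 1) * x0) / (r + 1)"
    and \<alpha>: "\<alpha> = (c * r + (r + 1) * x0 - 1)\<^sup>2 / (r + 1)"
    and u: "c * r + (r + 1) * x0 - 1 - (r + 1) * u \<noteq> 0"
  shows "distinguished_restriction \<alpha> \<beta> r \<delta> \<eta> c x0 u =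
    r * (r + 1)\<^sup>2 * x0 * u\<^sup>2 * (x0 + u) / (c * r + (r + 1) * x0 - 1 - (r + 1) * u)"
proof -
  define s where "s = r + 1"
  define d where "d = c * r + s * x0 - 1"
  define x where "x = x0 + u"
  have s0: "s \<noteq> 0" and du: "d - s * u \<noteq> 0"
    using s u by (simp_all add: s_def d_def)
  then have ud: "s * u - d \<noteq> 0" by auto
  have "x + \<beta> = (s * u - d) / s"
    using s0 unfolding \<beta> x_def d_def s_def by (simp add: field_simps)
  moreover have "\<alpha> = d\<^sup>2 / s" unfolding \<alpha> d_def s_def ..
  ultimately have resp: "\<alpha> * x / (x + \<beta>) = x * d\<^sup>2 / (s * u - d)"
    using s0 by simp
  have "x * (1 - x) - r * x * (x + c) = - x * (d + s * u)"
    unfolding x_def d_def s_def by (simp add: algebra_simps)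
  then have "x * (1 - x) - \<alpha> * x / (x + \<beta>) - r * x * (x + c)
      = - x * (d + s * u) - x * d\<^sup>2 / (s * u - d)"
    unfolding resp by linarith
  also have "\<dots> = s\<^sup>2 * u\<^sup>2 * x / (d - s * u)"
    using du ud by (simp add: divide_simps) (simp add: algebra_simps power2_eq_square)
  finally show ?thesis
    using distinguished_restriction_prey[OF assms(1), of \<alpha> \<beta> \<delta> \<eta> c u]
    unfolding x_def[symmetric] s_def[symmetric] d_def[symmetric] by (simp add: mult_ac)
qed

theorem corollary6p6:
  fixes \<alpha> \<beta> r \<delta> \<eta> c x0 :: real
    and R :: "real \<Rightarrow> real" and g :: "nat \<Rightarrow> real"
  assumes "x0 > 0" and "x0 + c > 0"
    and "r * x0 \<noteq> 0" and "r + 1 \<noteq> 0" and "1 + \<eta> * (x0 + c) \<noteq> 0"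
    and "c * r + (r + 1) * x0 - 1 \<noteq> 0"
    and "\<beta> = (1 - c * r - 2 * (r + 1) * x0) / (r + 1)"
    and "\<delta> = r * x0 * (1 + \<eta> * (x0 + c))"
    and "\<alpha> = (c * r + (r + 1) * x0 - 1)\<^sup>2 / (r + 1)"
  defines "R \<equiv> distinguished_restriction \<alpha> \<beta> r \<delta> \<eta> c x0"
    and "g \<equiv> taylor_coeff R"
  shows "(\<exists>\<rho>>0. \<forall>u. \<bar>u\<bar> < \<rho> \<longrightarrow> (\<lambda>k. g (k + 2) * u ^ (k + 2)) sums R u)
    \<and> (\<beta> = 0 \<longleftrightarrow> c * r + 2 * (r + 1) * x0 - 1 = 0)
    \<and> (\<beta> = 0 \<longrightarrow>
         (\<forall>k\<ge>3. g k = 0) \<and>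
         (\<forall>u. x0 + u \<noteq> 0 \<longrightarrow> R u = - r * (r + 1) * x0 * u\<^sup>2))"
proof -
  define d where "d = c * r + (r + 1) * x0 - 1"
  have d0: "d \<noteq> 0" using assms(6) by (simp add: d_def)
  have R: "R u = r * (r + 1)\<^sup>2 * x0 * u\<^sup>2 * (x0 + u) / (d - (r + 1) * u)"
    if "d - (r + 1) * u \<noteq> 0" for u
    using distinguished_restriction_eq[OF assms(3,4,7,9)] that by (simp add: R_def d_def)

  define h where "h u = r * (r + 1)\<^sup>2 * x0 * (x0 + u) / (d - (r + 1) * u)" for u
  define H where "H = fps_const (r * (r + 1)\<^sup>2 * x0) * (fps_const x0 + fps_X)
      / (fps_const d - fps_const (r + 1) * fps_X)"
  have "h has_fps_expansion H"
    unfolding h_def H_def using d0 by (intro fps_expansion_intros) auto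
  then have *: "(\<lambda>u. u ^ 2 * h u) has_fps_expansion fps_X ^ 2 * H"
    by (intro fps_expansion_intros)
  have "eventually (\<lambda>u. u \<in> {u. d - (r + 1) * u \<noteq> 0}) (nhds 0)"
    using d0 by (intro eventually_nhds_in_open open_Collect_neq continuous_intros) auto
  then have ev: "eventually (\<lambda>u. u ^ 2 * h u = R u) (nhds 0)"
    by eventually_elim (simp add: R h_def)
  have exp: "R has_fps_expansion fps_X ^ 2 * H"
    using * has_fps_expansion_cong[OF ev refl] by blast
  have g: "g k = fps_nth (fps_X ^ 2 * H) k" for k
    unfolding g_def by (rule taylor_coeff_eq_fps_nth[OF exp])
  have g01: "g 0 = 0" "g 1 = 0"
    by (simp_all add: g fps_X_power_mult_nth)
  obtain \<rho> where "\<rho> > 0" and \<rho>: "\<And>u. \<bar>u\<bar> < \<rho> \<Longrightarrow> (\<lambda>k. g k * u ^ k) sums R u"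
    using has_fps_expansion_sums[OF exp] unfolding g real_norm_def by blast
  have "(\<lambda>k. g (k + 2) * u ^ (k + 2)) sums R u" if "\<bar>u\<bar> < \<rho>" for u
    using \<rho>[OF that] g01 by (subst sums_iff_shift) (simp add: numeral_2_eq_2)
  then have series: "\<exists>\<rho>>0. \<forall>u. \<bar>u\<bar> < \<rho> \<longrightarrow> (\<lambda>k. g (k + 2) * u ^ (k + 2)) sums R u"
    using \<open>\<rho> > 0\<close> by blast

  have locus: "\<beta> = 0 \<longleftrightarrow> c * r + 2 * (r + 1) * x0 - 1 = 0"
    unfolding assms(7) using assms(4) by auto

  have R_quadratic: "R u = - r * (r + 1) * x0 * u\<^sup>2" if "\<beta> = 0" "x0 + u \<noteq> 0" for u
  proof -
    have den: "d - (r + 1) * u = - ((r + 1) * (x0 + u))"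
      using that(1) locus by (simp add: d_def algebra_simps)
    have cancel: "r * s\<^sup>2 * x0 * u\<^sup>2 * x / - (s * x) = - r * s * x0 * u\<^sup>2"
      if "s \<noteq> 0" "x \<noteq> 0" for s x :: real
      using that by (simp add: power2_eq_square)
    show ?thesis
      using R[of u] cancel[OF assms(4) that(2)] that(2) assms(4) unfolding den by simp
  qed
  have "g k = 0" if "\<beta> = 0" "k \<ge> 3" for k
  proof -
    \<comment> \<open>The radius \<open>x0\<close> keeps \<open>x0 + u\<close> away from \<open>0\<close>, where the cancellation breaks down.\<close>
    have "eventually (\<lambda>u. u \<in> ball 0 x0) (nhds 0)"
      using assms(1) by (intro eventually_nhds_in_open) auto
    then have "eventually (\<lambda>u. - r * (r + 1) * x0 * u\<^sup>2 = R u) (nhds 0)"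
      by eventually_elim (subst R_quadratic[OF that(1)], auto)
    moreover have "(\<lambda>u. - r * (r + 1) * x0 * u\<^sup>2)
        has_fps_expansion fps_const (- r * (r + 1) * x0) * fps_X ^ 2"
      by (intro fps_expansion_intros)
    ultimately have "R has_fps_expansion fps_const (- r * (r + 1) * x0) * fps_X ^ 2"
      by (rule iffD1[OF has_fps_expansion_cong[OF _ refl]])
    from taylor_coeff_eq_fps_nth[OF this, of k] that(2) show ?thesis
      by (simp add: g_def)
  qed
  with series locus R_quadratic show ?thesis by blast
qed

end
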